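(* Let $n,k,d,t$ be integers with $k\ge t$, $d\ge 2$, $t\ge 1$ and $n>(t+d-1)(k-t-d+3)$. If $\mathcal{F}\subseteq\binom{[n]}{k}$ is a $d$-wise $t$-intersecting family, then $$|\mathcal{F}|\le\binom{n-t}{k-t},$$ and equality holds only if $\mathcal{F}$ is isomorphic to $\left\{F\in\binom{[n]}{k}: [t]\subseteq F\right\}$.
   Context: Notation: $[n]=\{1,\dots,n\}$ and $\binom{[n]}{k}$ is the set of all $k$-element subsets of $[n]$. A family $\mathcal{F}\subseteq 2^{[n]}$ is $d$-wise $t$-intersecting if $|F_1\cap\cdots\cap F_d|\ge t$ for all $F_1,\dots,F_d\in\mathcal{F}$. Two families of subsets of $[n]$ are isomorphic if one is the image of the other under a permutation of $[n]$. *)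

theory Defs
  imports Main "HOL-Library.Ramsey" "HOL-Combinatorics.Permutations"
begin

(* The d members need not be distinct. Finiteness of the intersection is not required here;
   it is automatic for families of subsets of {1..n} and d > 0. *)
definition wise_intersecting :: "nat \<Rightarrow> nat \<Rightarrow> 'a set set \<Rightarrow> bool" where
  "wise_intersecting d t \<F> \<longleftrightarrow>
     (\<forall>F :: nat \<Rightarrow> 'a set. (\<forall>i\<in>{1..d}. F i \<in> \<F>) \<longrightarrow> t \<le> card (\<Inter>i\<in>{1..d}. F i))"

definition isomorphic_families :: "nat \<Rightarrow> nat set set \<Rightarrow> nat set set \<Rightarrow> bool" where
  "isomorphic_families n \<F> \<G> \<longleftrightarrow> (\<exists>\<pi>. \<pi> permutes {1..n} \<and> \<G> = (\<lambda>A. \<pi> ` A) ` \<F>)"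

end

theory Submission
  imports Defs
begin

text \<open>A \<open>d\<close>-wise \<open>t\<close>-intersecting family either has a core, that is, \<open>t\<close> elements common to all
  members, or it is \<open>(d - 1)\<close>-wise \<open>(t + 1)\<close>-intersecting: if \<open>d - 1\<close> members met in only \<open>t\<close>
  elements, every member would contain these elements. A family with a core lies in a star and is
  settled at once. Since a core of \<open>t + 1\<close> elements contains one of \<open>t\<close>, the argument can be repeated
  for a family without a core, which is therefore pairwise \<open>(t + d - 2)\<close>-intersecting
  (\<open>intersecting_if_wise_intersecting\<close>). With \<open>s = t + d - 2\<close> the hypothesis on \<open>n\<close> reads
  \<open>n > (s + 1) * (k - s + 1)\<close>, which is the threshold of Frankl and Wilson in the theorem of Erdos,
  Ko and Rado. The heart of the matter is thus the case \<open>d = 2\<close>, with uniqueness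
  (\<open>intersecting_family_bound\<close>).

  For pairwise intersections, consider a \<open>t\<close>-intersecting family of maximum size. Replacing larger elements by
  smaller ones preserves the size of the family and the intersection property and eventually makes
  the family compressed; and if the outcome of such a replacement is a star, the family was a star before it
  (\<open>star_if_compress_star\<close>). So the family may be assumed to be compressed, and it remains to show that it is
  the star of \<open>{1..t}\<close> (\<open>family_eq_star\<close>).

  This is done by the method of generating sets of Ahlswede and Khachatrian. Call a set a kernel if
  all \<open>k\<close>-sets above it belong to the family, and let \<open>l\<close> be least such that every member meets
  \<open>{1..l}\<close> in a kernel. Any two kernels meet in \<open>t\<close> elements, so \<open>l \<le> t\<close> makes the family a star. If
  \<open>l > t\<close>, some kernels in \<open>{1..l}\<close> contain \<open>l\<close> and need it. Deleting \<open>l\<close> from some of them would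
  enlarge the family, so there must be obstacles to it; since the family is compressed, two such kernels \<open>E\<close>
  and \<open>E'\<close> obstruct each other only if they cover \<open>{1..l}\<close> and \<open>card E + card E' = l + t\<close>
  (\<open>tight_critical\<close>). Giving up the obstacles and deleting \<open>l\<close> from the rest produces another
  \<open>t\<close>-intersecting family, and above the threshold the gain exceeds the loss
  (\<open>no_critical_beyond_t\<close>), against maximality.\<close>

section \<open>Intersecting families and stars\<close>

definition intersecting :: "nat \<Rightarrow> 'a set set \<Rightarrow> bool" where
  "intersecting t \<F> \<longleftrightarrow> (\<forall>A\<in>\<F>. \<forall>B\<in>\<F>. t \<le> card (A \<inter> B))"

definition star :: "'a set \<Rightarrow> nat \<Rightarrow> 'a set \<Rightarrow> 'a set set" where
  "star V k T = {A \<in> nsets V k. T \<subseteq> A}"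

lemma intersectingD: "intersecting t \<F> \<Longrightarrow> A \<in> \<F> \<Longrightarrow> B \<in> \<F> \<Longrightarrow> t \<le> card (A \<inter> B)"
  by (simp add: intersecting_def)

lemma finite_star [simp]: "finite V \<Longrightarrow> finite (star V k T)"
  by (simp add: star_def finite_imp_finite_nsets)

lemma star_subset_nsets: "star V k T \<subseteq> nsets V k"
  by (auto simp: star_def)

lemma star_intersecting: "intersecting (card T) (star V k T)"
  by (auto simp: intersecting_def star_def nsets_def intro!: card_mono)

lemma card_star:
  assumes "finite V" "T \<subseteq> V" "card T \<le> k"
  shows "card (star V k T) = (card V - card T) choose (k - card T)"
proof -
  have fT: "finite T" using assms finite_subset by blast
  have "bij_betw (\<lambda>X. X \<union> T) (nsets (V - T) (k - card T)) (star V k T)"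
  proof (rule bij_betw_byWitness[where f' = "\<lambda>A. A - T"])
    have "card (X \<union> T) = k" if "X \<in> nsets (V - T) (k - card T)" for X
      using that assms(3) fT by (subst card_Un_disjoint) (auto simp: nsets_def)
    then show "(\<lambda>X. X \<union> T) ` nsets (V - T) (k - card T) \<subseteq> star V k T"
      using assms(2) fT by (auto simp: star_def nsets_def)
    show "(\<lambda>A. A - T) ` star V k T \<subseteq> nsets (V - T) (k - card T)"
      using fT by (auto simp: star_def nsets_def card_Diff_subset)
  qed (auto simp: star_def nsets_def)
  then have "card (star V k T) = card (nsets (V - T) (k - card T))"
    by (rule bij_betw_same_card[symmetric])
  also have "\<dots> = (card V - card T) choose (k - card T)"
    using assms fT by (simp add: card_Diff_subset)
  finally show ?thesis .
qed

text \<open>Any bijection from \<open>T\<close> to \<open>{1..t}\<close>, glued to any bijection between the complements, is a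
  permutation that carries one star to the other.\<close>

lemma star_isomorphic_initial:
  assumes "T \<subseteq> {1..n}" "card T = t"
  shows "isomorphic_families n (star {1..n} k T) (star {1..n} k {1..t})"
proof -
  have tn: "t \<le> n" using assms card_mono[of "{1..n}" T] by simp
  have fT: "finite T" using assms finite_subset by blast
  obtain f where f: "bij_betw f T {1..t}"
    using finite_same_card_bij[OF fT, of "{1..t}"] assms(2) by auto
  have "card ({1..n} - T) = card ({1..n} - {1..t})"
    using assms tn fT by (simp add: card_Diff_subset)
  then obtain g where g: "bij_betw g ({1..n} - T) ({1..n} - {1..t})"
    using finite_same_card_bij[of "{1..n} - T" "{1..n} - {1..t}"] by auto
  define p where "p x = (if x \<in> T then f x else if x \<in> {1..n} then g x else x)" for x
  have pT: "bij_betw p T {1..t}"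
    using f by (rule bij_betw_cong[THEN iffD1, rotated]) (simp add: p_def)
  have pC: "bij_betw p ({1..n} - T) ({1..n} - {1..t})"
    using g by (rule bij_betw_cong[THEN iffD1, rotated]) (simp add: p_def)
  have "bij_betw p (T \<union> ({1..n} - T)) ({1..t} \<union> ({1..n} - {1..t}))"
    by (rule bij_betw_combine[OF pT pC]) auto
  moreover have "T \<union> ({1..n} - T) = {1..n}" "{1..t} \<union> ({1..n} - {1..t}) = {1..n}"
    using assms(1) tn by auto
  ultimately have bp: "bij_betw p {1..n} {1..n}" by simp
  have perm: "p permutes {1..n}"
    by (rule bij_imp_permutes[OF bp]) (use assms(1) in \<open>auto simp: p_def\<close>)
  have inj: "inj p" using perm by (rule permutes_inj)
  have imT: "p ` T = {1..t}" using pT by (simp add: bij_betw_def)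
  have "star {1..n} k {1..t} = (\<lambda>A. p ` A) ` star {1..n} k T"
  proof -
    have "(\<lambda>A. p ` A) ` nsets {1..n} k = nsets {1..n} k"
      using bij_betw_nsets[OF bp] by (simp add: bij_betw_def)
    moreover have "{1..t} \<subseteq> p ` A \<longleftrightarrow> T \<subseteq> A" for A
      using inj unfolding imT[symmetric] by (rule inj_image_subset_iff)
    ultimately have im: "X \<in> (\<lambda>A. p ` A) ` nsets {1..n} k \<longleftrightarrow> X \<in> nsets {1..n} k"
      and sub: "{1..t} \<subseteq> p ` A \<longleftrightarrow> T \<subseteq> A" for X A by simp_all
    show ?thesis
    proof (rule set_eqI)
      fix X
      have "X \<in> star {1..n} k {1..t} \<longleftrightarrow> (\<exists>A\<in>nsets {1..n} k. X = p ` A) \<and> {1..t} \<subseteq> X"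
        using im[of X] by (simp add: star_def image_iff)
      also have "\<dots> \<longleftrightarrow> X \<in> (\<lambda>A. p ` A) ` star {1..n} k T"
        using sub by (auto simp: star_def)
      finally show "X \<in> star {1..n} k {1..t} \<longleftrightarrow> X \<in> (\<lambda>A. p ` A) ` star {1..n} k T" .
    qed
  qed
  then show ?thesis using perm unfolding isomorphic_families_def by blast
qed

section \<open>Compression\<close>

definition exchange :: "'a \<Rightarrow> 'a \<Rightarrow> 'a set \<Rightarrow> 'a set" where
  "exchange i j A = insert i (A - {j})"

text \<open>A member \<open>A\<close> moves under the compression of \<open>\<F>\<close> exactly if \<open>exchange i j A\<close> is a genuine
  exchange whose place in \<open>\<F>\<close> is still vacant; this vacancy is what keeps the compression
  injective.\<close>

definition movable :: "'a \<Rightarrow> 'a \<Rightarrow> 'a set set \<Rightarrow> 'a set \<Rightarrow> bool" where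
  "movable i j \<F> A \<longleftrightarrow> j \<in> A \<and> i \<notin> A \<and> exchange i j A \<notin> \<F>"

definition compress_set :: "'a \<Rightarrow> 'a \<Rightarrow> 'a set set \<Rightarrow> 'a set \<Rightarrow> 'a set" where
  "compress_set i j \<F> A = (if movable i j \<F> A then exchange i j A else A)"

definition compress :: "'a \<Rightarrow> 'a \<Rightarrow> 'a set set \<Rightarrow> 'a set set" where
  "compress i j \<F> = compress_set i j \<F> ` \<F>"

lemma inj_on_compress_set: "inj_on (compress_set i j \<F>) \<F>"
proof (rule inj_onI)
  fix A B assume AB: "A \<in> \<F>" "B \<in> \<F>" and eq: "compress_set i j \<F> A = compress_set i j \<F> B"
  have "A = B" if "movable i j \<F> A" "movable i j \<F> B"
  proof -
    have "insert i (A - {j}) = insert i (B - {j})"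
      using eq that by (simp add: compress_set_def exchange_def)
    moreover have "A = insert j (insert i (A - {j}) - {i})" "B = insert j (insert i (B - {j}) - {i})"
      using that by (auto simp: movable_def)
    ultimately show ?thesis by metis
  qed
  then show "A = B"
    using AB eq by (auto simp: compress_set_def movable_def split: if_splits)
qed

lemma card_compress: "card (compress i j \<F>) = card \<F>"
  unfolding compress_def by (rule card_image[OF inj_on_compress_set])

lemma exchange_in_nsets:
  assumes "A \<in> nsets V k" "i \<in> V" "j \<in> A" "i \<notin> A"
  shows "exchange i j A \<in> nsets V k"
proof -
  have "finite A" "card A = k" using assms by (auto simp: nsets_def)
  then have "card (exchange i j A) = k"
    using assms by (simp add: exchange_def card_Diff_singleton card_gt_0_iff)
       (metis Suc_pred card_gt_0_iff empty_iff)
  then show ?thesis using assms by (auto simp: nsets_def exchange_def)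
qed

lemma compress_subset_nsets:
  assumes "\<F> \<subseteq> nsets V k" "i \<in> V"
  shows "compress i j \<F> \<subseteq> nsets V k"
  using assms exchange_in_nsets[of _ V k i j]
  by (auto simp: compress_def compress_set_def movable_def)

text \<open>The only delicate pair consists of a member \<open>A\<close> that moves and a member \<open>B\<close> with \<open>j \<in> B\<close>,
  \<open>i \<notin> B\<close> that stays. Then \<open>B\<close> stays because \<open>exchange i j B\<close> already lies in \<open>\<F>\<close>, and \<open>A\<close> meets
  \<open>exchange i j B\<close> in the same set in which the moved \<open>A\<close> meets \<open>B\<close>.\<close>

lemma intersecting_compress:
  assumes int: "intersecting t \<F>" and fin: "\<And>A. A \<in> \<F> \<Longrightarrow> finite A"
  shows "intersecting t (compress i j \<F>)"
proof -
  have one: "t \<le> card (exchange i j A \<inter> B)"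
    if A: "A \<in> \<F>" "movable i j \<F> A" and B: "B \<in> \<F>" "\<not> movable i j \<F> B" for A B
  proof -
    have AB: "t \<le> card (A \<inter> B)" using int A B by (simp add: intersectingD)
    have fA: "finite A" using fin A by simp
    have jA: "j \<in> A" "i \<notin> A" using A by (auto simp: movable_def)
    consider "j \<notin> B" | "j \<in> B" "i \<in> B" | "j \<in> B" "i \<notin> B" "exchange i j B \<in> \<F>"
      using B by (auto simp: movable_def)
    then show ?thesis
    proof cases
      case 1
      then have "A \<inter> B \<subseteq> exchange i j A \<inter> B" by (auto simp: exchange_def)
      then have "card (A \<inter> B) \<le> card (exchange i j A \<inter> B)"
        using fA by (intro card_mono) (auto simp: exchange_def)
      with AB show ?thesis by simp
    next
      case 2
      then have "exchange i j A \<inter> B = insert i ((A \<inter> B) - {j})" by (auto simp: exchange_def)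
      then show ?thesis
        using AB jA 2 fA by (simp add: card_Diff_singleton)
    next
      case 3
      have "t \<le> card (A \<inter> exchange i j B)" using int A(1) 3(3) by (rule intersectingD)
      moreover have "A \<inter> exchange i j B = exchange i j A \<inter> B"
        using jA 3 by (auto simp: exchange_def)
      ultimately show ?thesis by simp
    qed
  qed
  have both: "t \<le> card (exchange i j A \<inter> exchange i j B)"
    if A: "A \<in> \<F>" "movable i j \<F> A" and B: "B \<in> \<F>" "movable i j \<F> B" for A B
  proof -
    have "exchange i j A \<inter> exchange i j B = insert i ((A \<inter> B) - {j})"
      by (auto simp: exchange_def)
    moreover have "card (insert i ((A \<inter> B) - {j})) = card (A \<inter> B)"
      using A B fin[of A]
      by (simp add: movable_def card_Diff_singleton)
        (metis IntI Suc_pred card_gt_0_iff empty_iff finite_Int)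
    ultimately show ?thesis using int A B by (simp add: intersectingD)
  qed
  show ?thesis
    unfolding intersecting_def compress_def
    using one both int by (auto simp: compress_set_def Int_commute intersectingD)
qed

text \<open>Compressing towards smaller elements terminates because this number drops.\<close>

definition weight :: "nat set set \<Rightarrow> nat" where
  "weight \<F> = (\<Sum>A\<in>\<F>. \<Sum>A)"

lemma weight_compress:
  assumes "i < j" "finite \<F>" and fin: "\<And>A. A \<in> \<F> \<Longrightarrow> finite A" and mov: "A \<in> \<F>" "movable i j \<F> A"
  shows "weight (compress i j \<F>) < weight \<F>"
proof -
  have lt: "\<Sum>(compress_set i j \<F> B) < \<Sum>B" if "B \<in> \<F>" "movable i j \<F> B" for B
  proof -
    have "finite B" using fin that by simp
    then have "\<Sum>B = j + \<Sum>(B - {j})" "\<Sum>(exchange i j B) = i + \<Sum>(B - {j})"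
      using that by (auto simp: exchange_def movable_def sum.remove)
    then show ?thesis using that assms(1) by (simp add: compress_set_def)
  qed
  have "weight (compress i j \<F>) = (\<Sum>B\<in>\<F>. \<Sum>(compress_set i j \<F> B))"
    unfolding weight_def compress_def by (simp add: sum.reindex[OF inj_on_compress_set])
  also have "\<dots> < (\<Sum>B\<in>\<F>. \<Sum>B)"
  proof (rule sum_strict_mono_ex1[OF assms(2)])
    show "\<forall>B\<in>\<F>. \<Sum>(compress_set i j \<F> B) \<le> \<Sum>B"
      using lt by (metis compress_set_def less_or_eq_imp_le order_refl)
    show "\<exists>B\<in>\<F>. \<Sum>(compress_set i j \<F> B) < \<Sum>B" using lt mov by blast
  qed
  finally show ?thesis by (simp add: weight_def)
qed

section \<open>A family that compresses to a star is a star\<close>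

text \<open>Kneser graphs on more than \<open>2 * m\<close> points are connected: two \<open>m\<close>-sets that differ by a single
  exchange cover only \<open>m + 1\<close> points, so some \<open>m\<close>-set is disjoint from both, and single exchanges
  lead from any \<open>m\<close>-set to any other.\<close>

lemma disjointness_connects_nsets:
  assumes "finite W" "2 * m + 1 \<le> card W"
    and step: "\<And>X Y. X \<in> nsets W m \<Longrightarrow> Y \<in> nsets W m \<Longrightarrow> X \<inter> Y = {} \<Longrightarrow> P X \<Longrightarrow> P Y"
    and "X \<in> nsets W m" "Y \<in> nsets W m" "P X"
  shows "P Y"
  using assms(4-6)
proof (induction "card (X - Y)" arbitrary: X rule: less_induct)
  case less
  have X: "X \<subseteq> W" "finite X" "card X = m" and Y: "Y \<subseteq> W" "finite Y" "card Y = m"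
    using less.prems by (auto simp: nsets_def)
  show ?case
  proof (cases "X = Y")
    case True with less.prems show ?thesis by simp
  next
    case False
    then have "\<not> X \<subseteq> Y" "\<not> Y \<subseteq> X" using X Y card_subset_eq by metis+
    then obtain x y where x: "x \<in> X" "x \<notin> Y" and y: "y \<in> Y" "y \<notin> X" by blast
    \<comment> \<open>one step towards \<open>Y\<close>; the set \<open>Z\<close> below is disjoint from \<open>X\<close> and from \<open>X'\<close>\<close>
    define X' where "X' = exchange y x X"
    have X': "X' \<in> nsets W m"
      unfolding X'_def by (rule exchange_in_nsets[OF less.prems(1)]) (use x y Y in auto)
    have "card (W - insert y X) = card W - (m + 1)"
      using X y Y by (subst card_Diff_subset) auto
    then have "m \<le> card (W - insert y X)" using assms(2) by linarith
    then obtain Z where Z: "Z \<subseteq> W - insert y X" "card Z = m" "finite Z"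
      by (rule obtain_subset_with_card_n)
    then have Zn: "Z \<in> nsets W m" by (auto simp: nsets_def)
    have "P Z" using step[OF less.prems(1) Zn _ less.prems(3)] Z by auto
    then have "P X'" using step[OF Zn X'] Z by (auto simp: X'_def exchange_def)
    moreover have "X' - Y \<subset> X - Y" using x y by (auto simp: X'_def exchange_def)
    then have "card (X' - Y) < card (X - Y)" using X by (intro psubset_card_mono) auto
    ultimately show ?thesis using less.hyps X' less.prems(2) by blast
  qed
qed

text \<open>Only the case \<open>i \<in> T\<close>, \<open>j \<notin> T\<close> needs work, since otherwise moving a set cannot make it contain
  \<open>T\<close> if it did not before. Put \<open>U = T - {i}\<close>. For every \<open>(k - t)\<close>-set \<open>X\<close> that avoids \<open>T\<close> and \<open>j\<close>,
  exactly one of \<open>X \<union> U \<union> {i}\<close> and \<open>X \<union> U \<union> {j}\<close> lies in \<open>\<F>\<close>. Disjoint sets \<open>X\<close> and \<open>Y\<close> make the same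
  choice, for otherwise two members of \<open>\<F>\<close> meet only in \<open>U\<close>, which has \<open>t - 1\<close> elements. Since
  the disjointness graph is connected, all \<open>X\<close> make the same choice, and \<open>\<F>\<close> is the star of
  \<open>T\<close> or that of \<open>U \<union> {j}\<close>.\<close>

lemma star_if_compress_star:
  assumes V: "finite V" "\<F> \<subseteq> nsets V k" "i \<in> V" "j \<in> V" "i \<noteq> j"
    and T: "T \<subseteq> V" "card T = t" "1 \<le> t" "t \<le> k" and big: "2 * (k - t) + t + 2 \<le> card V"
    and int: "intersecting t \<F>" and comp: "compress i j \<F> = star V k T"
  shows "\<exists>T'. T' \<subseteq> V \<and> card T' = t \<and> \<F> = star V k T'"
proof -
  have fT: "finite T" using T V finite_subset by blast
  have card_eq: "card \<F> = card (star V k T)" using comp card_compress[of i j \<F>] by simp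
  have comp_in: "compress_set i j \<F> A \<in> star V k T" if "A \<in> \<F>" for A
    using that comp by (auto simp: compress_def)
  have finish: "\<F> = star V k T'" if "T' \<subseteq> V" "card T' = t" "\<And>A. A \<in> \<F> \<Longrightarrow> T' \<subseteq> A" for T'
  proof (rule card_subset_eq)
    show "card \<F> = card (star V k T')"
      using card_eq card_star[of V T k] card_star[of V T' k] V T that by simp
    show "\<F> \<subseteq> star V k T'" using that V by (auto simp: star_def)
  qed (use V in simp)
  show ?thesis
  proof (cases "i \<in> T \<and> j \<notin> T")
    case False
    have "T \<subseteq> A" if "A \<in> \<F>" for A
    proof (cases "movable i j \<F> A")
      case True
      then have "T \<subseteq> insert i (A - {j})"
        using comp_in[OF that] by (simp add: compress_set_def star_def exchange_def)
      with False V(5) show ?thesis by blast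
    next
      case False
      then show ?thesis using comp_in[OF that] by (simp add: compress_set_def star_def)
    qed
    then show ?thesis using finish[of T] T by blast
  next
    case True
    define U where "U = T - {i}"
    have U: "T = insert i U" "i \<notin> U" "j \<notin> U" "finite U" "card U = t - 1" "U \<subseteq> V"
      using True T fT by (auto simp: U_def)
    define W where "W = V - insert j T"
    have W: "finite W" "card W = card V - (t + 1)"
      unfolding W_def using V T True fT by (simp_all add: card_Diff_subset)
    let ?m = "k - t"
    define P where "P X \<longleftrightarrow> X \<union> T \<in> \<F>" for X
    define Q where "Q X \<longleftrightarrow> X \<union> insert j U \<in> \<F>" for X
    have XW: "finite X" "card X = ?m" "i \<notin> X" "j \<notin> X" "X \<inter> T = {}" "X \<inter> U = {}" "X \<subseteq> V"
      if "X \<in> nsets W ?m" for X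
      using that U by (auto simp: nsets_def W_def)
    have ex: "exchange i j (X \<union> insert j U) = X \<union> T" if "X \<in> nsets W ?m" for X
      using XW[OF that] U V(5) by (auto simp: exchange_def)
    have PQ: "Q X \<longleftrightarrow> \<not> P X" if X: "X \<in> nsets W ?m" for X
    proof
      assume "Q X"
      show "\<not> P X"
      proof
        assume "P X"
        then have "\<not> movable i j \<F> (X \<union> insert j U)" using ex[OF X] by (simp add: movable_def P_def)
        then have "X \<union> insert j U \<in> star V k T"
          using comp_in[of "X \<union> insert j U"] \<open>Q X\<close> by (simp add: Q_def compress_set_def)
        then show False using XW[OF X] U V(5) by (auto simp: star_def)
      qed
    next
      assume nP: "\<not> P X"
      have "card (X \<union> T) = k" using XW[OF X] fT T by (simp add: card_Un_disjoint)
      then have "X \<union> T \<in> star V k T" using XW[OF X] T fT by (auto simp: star_def nsets_def)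
      then obtain A where A: "A \<in> \<F>" "compress_set i j \<F> A = X \<union> T"
        using comp unfolding compress_def by (metis imageE)
      with nP have mv: "movable i j \<F> A" "exchange i j A = X \<union> T"
        by (auto simp: compress_set_def P_def split: if_splits)
      then have "A = insert j (X \<union> T - {i})" by (auto simp: movable_def exchange_def)
      also have "\<dots> = X \<union> insert j U" using XW(3)[OF X] U(1,2) by auto
      finally have "A = X \<union> insert j U" .
      then show "Q X" using A by (simp add: Q_def)
    qed
    have step: "P Y" if "X \<in> nsets W ?m" "Y \<in> nsets W ?m" "X \<inter> Y = {}" "P X" for X Y
    proof (rule ccontr)
      assume "\<not> P Y"
      then have "Q Y" using PQ that by simp
      then have "t \<le> card ((X \<union> T) \<inter> (Y \<union> insert j U))"
        using int that(4) by (simp add: intersectingD P_def Q_def)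
      also have "(X \<union> T) \<inter> (Y \<union> insert j U) = U"
        using XW[OF that(1)] XW[OF that(2)] that(3) U V(5) by blast
      finally show False using U T by simp
    qed
    have conn: "P Y" if "X \<in> nsets W ?m" "Y \<in> nsets W ?m" "P X" for X Y
      using disjointness_connects_nsets[of W ?m P X Y] step that W big by auto
    have rest: "A - insert i (insert j U) \<in> nsets W ?m"
      if "A \<in> nsets V k" "U \<subseteq> A" "(i \<in> A) \<noteq> (j \<in> A)" for A
    proof -
      have A: "finite A" "card A = k" "A \<subseteq> V" using that by (auto simp: nsets_def)
      have "A - insert i (insert j U) = A - (if i \<in> A then insert i U else insert j U)"
        using that by auto
      moreover have "card (A - (if i \<in> A then insert i U else insert j U)) = k - t"
        using A U that T by (subst card_Diff_subset) auto
      ultimately show ?thesis using A by (auto simp: nsets_def W_def U)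
    qed
    show ?thesis
    proof (cases "\<exists>X\<in>nsets W ?m. P X")
      case True
      have "T \<subseteq> A" if A: "A \<in> \<F>" for A
      proof (rule ccontr)
        assume n: "\<not> T \<subseteq> A"
        then have mv: "movable i j \<F> A" and TA: "T \<subseteq> exchange i j A"
          using comp_in[OF A] by (auto simp: compress_set_def star_def split: if_splits)
        then have *: "U \<subseteq> A" "j \<in> A" "i \<notin> A"
          using U by (auto simp: exchange_def movable_def)
        let ?X = "A - insert i (insert j U)"
        have X: "?X \<in> nsets W ?m" using rest[of A] * A V by auto
        moreover have "?X \<union> insert j U = A" using * by auto
        then have "Q ?X" using A by (simp add: Q_def)
        ultimately show False using PQ conn True by blast
      qed
      then show ?thesis using finish[of T] T by blast
    next
      case False
      have "insert j U \<subseteq> A" if A: "A \<in> \<F>" for A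
      proof (cases "movable i j \<F> A")
        case True
        then have "T \<subseteq> exchange i j A"
          using comp_in[OF A] by (auto simp: compress_set_def star_def)
        with True show ?thesis using U by (auto simp: exchange_def movable_def)
      next
        case nm: False
        then have TA: "T \<subseteq> A" using comp_in[OF A] by (auto simp: compress_set_def star_def)
        have "j \<in> A"
        proof (rule ccontr)
          assume "j \<notin> A"
          let ?X = "A - insert i (insert j U)"
          have X: "?X \<in> nsets W ?m" using rest[of A] TA U \<open>j \<notin> A\<close> A V by auto
          moreover have "?X \<union> T = A" using TA U \<open>j \<notin> A\<close> by auto
          then have "P ?X" using A by (simp add: P_def)
          ultimately show False using False by blast
        qed
        then show ?thesis using TA U by blast
      qed
      moreover have "card (insert j U) = t" "insert j U \<subseteq> V" using U T V by auto
      ultimately show ?thesis using finish[of "insert j U"] by blast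
    qed
  qed
qed

section \<open>Compressed families of maximum size\<close>

lemma binomial_Suc_eq: "Suc p * (N choose Suc p) = (N - p) * (N choose p)"
  using binomial_absorption[of p N] binomial_absorb_comp[of N p] by simp

text \<open>By \<open>binomial_Suc_eq\<close>, the two successive ratios multiply to
  \<open>(N - p) * (N - q) / ((p + 1) * (q + 1))\<close>, where \<open>N - p > q + 1\<close> and \<open>N - q > p + 1\<close>.\<close>

lemma binomial_product_less:
  assumes "p + q + 2 \<le> N"
  shows "(N choose p) * (N choose q) < (N choose Suc p) * (N choose Suc q)"
proof -
  have "Suc p * Suc q * ((N choose p) * (N choose q)) < (N - q) * (N - p) * ((N choose p) * (N choose q))"
    using assms by (intro mult_strict_right_mono mult_strict_mono) auto
  also have "\<dots> = (Suc p * (N choose Suc p)) * (Suc q * (N choose Suc q))"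
    by (simp only: binomial_Suc_eq mult_ac)
  also have "\<dots> = Suc p * Suc q * ((N choose Suc p) * (N choose Suc q))"
    by (simp only: mult_ac)
  finally show ?thesis by (simp only: mult_less_cancel1)
qed

lemma card_trace_in:
  assumes "l \<le> n" "D \<subseteq> nsets {1..l} e" "e \<le> k"
  shows "card {A \<in> nsets {1..n} k. A \<inter> {1..l} \<in> D} = card D * ((n - l) choose (k - e))"
proof -
  let ?S = "{A \<in> nsets {1..n} k. A \<inter> {1..l} \<in> D}"
  let ?P = "D \<times> nsets {l+1..n} (k - e)"
  have D: "E \<subseteq> {1..l}" "finite E" "card E = e" if "E \<in> D" for E
    using assms that by (auto simp: nsets_def)
  have "bij_betw (\<lambda>(E, X). E \<union> X) ?P ?S"
  proof (rule bij_betw_byWitness[where f' = "\<lambda>A. (A \<inter> {1..l}, A - {1..l})"])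
    have low: "(E \<union> X) \<inter> {1..l} = E" "(E \<union> X) - {1..l} = X" 
      if "E \<in> D" "X \<in> nsets {l+1..n} (k - e)" for E X
      using D[OF that(1)] that(2) by (fastforce simp: nsets_def)+
    then show "\<forall>a\<in>?P. (\<lambda>A. (A \<inter> {1..l}, A - {1..l})) ((\<lambda>(E, X). E \<union> X) a) = a"
      by auto
    show "\<forall>A\<in>?S. (\<lambda>(E, X). E \<union> X) ((\<lambda>A. (A \<inter> {1..l}, A - {1..l})) A) = A" by auto
    have "E \<union> X \<in> ?S" if EX: "E \<in> D" "X \<in> nsets {l+1..n} (k - e)" for E X
    proof -
      have X: "X \<subseteq> {l+1..n}" "finite X" "card X = k - e" using EX by (auto simp: nsets_def)
      have "E \<inter> X = {}" using D[OF EX(1)] X by fastforce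
      then have "card (E \<union> X) = k" using D[OF EX(1)] X assms(3) by (simp add: card_Un_disjoint)
      then have "E \<union> X \<in> nsets {1..n} k"
        using D[OF EX(1)] X assms(1) by (fastforce simp: nsets_def)
      then show ?thesis using low EX by simp
    qed
    then show "(\<lambda>(E, X). E \<union> X) ` ?P \<subseteq> ?S" by auto
    have "A - {1..l} \<in> nsets {l+1..n} (k - e)" if "A \<in> ?S" for A
    proof -
      have A: "A \<subseteq> {1..n}" "finite A" "card A = k" "card (A \<inter> {1..l}) = e"
        using that D(3) by (auto simp: nsets_def)
      have "card (A - {1..l}) = k - e"
        using A card_Diff_subset_Int[of A "{1..l}"] by simp
      moreover have "A - {1..l} \<subseteq> {l+1..n}" using A(1) by fastforce
      ultimately show ?thesis using A by (simp add: nsets_def)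
    qed
    then show "(\<lambda>A. (A \<inter> {1..l}, A - {1..l})) ` ?S \<subseteq> ?P" by auto
  qed
  then have "card ?P = card ?S" by (rule bij_betw_same_card)
  then show ?thesis by (simp add: card_cartesian_product)
qed

text \<open>Most steps use the threshold on \<open>n\<close> only through this linear consequence.\<close>

lemma threshold_imp_linear_bound:
  fixes n k t :: nat
  assumes "1 \<le> t" "t \<le> k" "(t + 1) * (k - t + 1) < n"
  shows "2 * k + 2 \<le> n + t"
proof -
  obtain m where m: "k = t + m" using assms(2) le_Suc_ex by blast
  have "1 * m \<le> t * m" using assms(1) by (rule mult_le_mono1)
  moreover have "(t + 1) * (k - t + 1) = t * m + t + m + 1" using m by (simp add: algebra_simps)
  ultimately show ?thesis using assms(3) m by linarith
qed

text \<open>The reduced situation, in which the family turns out to be the star of \<open>{1..t}\<close>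
  (\<open>family_eq_star\<close>).\<close>

locale maximum_compressed_family =
  fixes n k t :: nat and \<F> :: "nat set set"
  assumes t_pos: "1 \<le> t" and t_le_k: "t \<le> k" and n_large: "(t + 1) * (k - t + 1) < n"
    and uniform: "\<F> \<subseteq> nsets {1..n} k"
    and intersects: "intersecting t \<F>"
    and maximum: "\<And>\<G>. \<G> \<subseteq> nsets {1..n} k \<Longrightarrow> intersecting t \<G> \<Longrightarrow> card \<G> \<le> card \<F>"
    and compressed: "\<And>A i j. A \<in> \<F> \<Longrightarrow> 1 \<le> i \<Longrightarrow> i < j \<Longrightarrow> j \<in> A \<Longrightarrow> i \<notin> A \<Longrightarrow> exchange i j A \<in> \<F>"
begin

text \<open>Kernels are the sets that force membership in \<open>\<F>\<close>: the generating sets of Ahlswede and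
  Khachatrian, here all of them and not just the inclusion-minimal ones. The bound on the size
  excludes the sets that do so vacuously.\<close>

definition kernels :: "nat set set" where
  "kernels = {E. E \<subseteq> {1..n} \<and> card E \<le> k \<and> (\<forall>A\<in>nsets {1..n} k. E \<subseteq> A \<longrightarrow> A \<in> \<F>)}"

text \<open>The kernels inside \<open>{1..l}\<close> that cannot do without their element \<open>l\<close>. If the trace of every
  member on \<open>{1..l}\<close> is a kernel and none of these traces is critical, then the traces on \<open>{1..l - 1}\<close> are
  kernels as well.\<close>

definition critical :: "nat \<Rightarrow> nat set set" where
  "critical l = {E \<in> kernels. E \<subseteq> {1..l} \<and> l \<in> E \<and> E - {l} \<notin> kernels}"

lemma n_bound: "2 * k + 2 \<le> n + t"
  using t_pos t_le_k n_large by (rule threshold_imp_linear_bound)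

lemma finite_family: "finite \<F>"
  using uniform by (rule finite_subset) (simp add: finite_imp_finite_nsets)

lemma familyD: "A \<in> \<F> \<Longrightarrow> A \<subseteq> {1..n}" "A \<in> \<F> \<Longrightarrow> finite A" "A \<in> \<F> \<Longrightarrow> card A = k"
  using uniform by (auto simp: nsets_def)

lemma kernelsD:
  "E \<in> kernels \<Longrightarrow> E \<subseteq> {1..n}" "E \<in> kernels \<Longrightarrow> card E \<le> k" "E \<in> kernels \<Longrightarrow> finite E"
  "E \<in> kernels \<Longrightarrow> A \<in> nsets {1..n} k \<Longrightarrow> E \<subseteq> A \<Longrightarrow> A \<in> \<F>"
  using finite_subset[of E "{1..n}"] by (auto simp: kernels_def)

lemma family_subset_kernels: "A \<in> \<F> \<Longrightarrow> A \<in> kernels"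
proof -
  assume A: "A \<in> \<F>"
  have "B = A" if "B \<in> nsets {1..n} k" "A \<subseteq> B" for B
    using that familyD[OF A] by (metis (mono_tags, lifting) card_subset_eq mem_Collect_eq nsets_def)
  then show "A \<in> kernels" using familyD[OF A] A by (auto simp: kernels_def)
qed

text \<open>New elements are taken outside \<open>G\<close> as long as there are any. If they run out, then \<open>A\<close> contains
  the whole complement of \<open>G\<close> and meets \<open>G\<close> in at most \<open>2 * k - n < t\<close> elements.\<close>

lemma extension_with_small_intersection:
  assumes E: "E \<subseteq> {1..n}" "card E \<le> k" and G: "G \<subseteq> {1..n}" "card G \<le> k"
    and small: "card (E \<inter> G) < t"
  shows "\<exists>A\<in>nsets {1..n} k. E \<subseteq> A \<and> card (A \<inter> G) < t"
proof -
  have fin: "finite E" "finite G" using E G finite_subset by auto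
  have k_le_n: "k \<le> n" using n_bound t_le_k by linarith
  let ?R = "{1..n} - (E \<union> G)"
  have card_ER: "card (E \<union> ?R) = card E + card ?R"
    using fin by (intro card_Un_disjoint) auto
  show ?thesis
  proof (cases "k \<le> card (E \<union> ?R)")
    case True
    obtain A where A: "E \<subseteq> A" "A \<subseteq> E \<union> ?R" "card A = k"
      using exists_subset_between[of E k "E \<union> ?R"] True E(2) fin by auto
    then have "A \<inter> G = E \<inter> G" by auto
    moreover have "finite A" using A(2) fin by (auto intro: finite_subset)
    ultimately show ?thesis using A E small by (intro bexI[of _ A]) (auto simp: nsets_def)
  next
    case False
    then obtain A where A: "E \<union> ?R \<subseteq> A" "A \<subseteq> {1..n}" "card A = k"
      using exists_subset_between[of "E \<union> ?R" k "{1..n}"] k_le_n E by auto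
    have fA: "finite A" using A(2) finite_subset by blast
    have "A - G = {1..n} - G" using A E by auto
    then have "card (A - G) = n - card G" using G fin by (simp add: card_Diff_subset)
    moreover have "card A = card (A \<inter> G) + card (A - G)"
      using fA by (metis card_Diff_subset_Int card_mono finite_Int inf_le1 le_add_diff_inverse)
    ultimately have "card (A \<inter> G) < t" using A(3) G(2) n_bound t_pos k_le_n by linarith
    then show ?thesis using A fA by (intro bexI[of _ A]) (auto simp: nsets_def)
  qed
qed

text \<open>Two kernels that met in fewer than \<open>t\<close> elements could be enlarged, one after the other, to
  members of \<open>\<F>\<close> that do so too.\<close>

lemma card_kernels_Int: 
  assumes E: "E1 \<in> kernels" "E2 \<in> kernels"
  shows "t \<le> card (E1 \<inter> E2)"
proof (rule ccontr)
  assume "\<not> t \<le> card (E1 \<inter> E2)"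
  then obtain A1 where A1: "A1 \<in> nsets {1..n} k" "E1 \<subseteq> A1" "card (A1 \<inter> E2) < t"
    using extension_with_small_intersection[of E1 E2] kernelsD(1,2)[OF E(1)] kernelsD(1,2)[OF E(2)]
    by auto
  have "A1 \<subseteq> {1..n}" "card A1 \<le> k" "card (E2 \<inter> A1) < t"
    using A1 by (auto simp: nsets_def Int_commute)
  then obtain A2 where A2: "A2 \<in> nsets {1..n} k" "E2 \<subseteq> A2" "card (A2 \<inter> A1) < t"
    using extension_with_small_intersection[of E2 A1] kernelsD(1,2)[OF E(2)] by auto
  have "t \<le> card (A2 \<inter> A1)"
    using kernelsD(4)[OF E(1) A1(1,2)] kernelsD(4)[OF E(2) A2(1,2)] intersects
    by (simp add: intersectingD)
  with A2 show False by simp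
qed

lemma exchange_kernel:
  assumes E: "E \<in> kernels" and ij: "1 \<le> i" "i < j" "j \<in> E" "i \<notin> E"
  shows "exchange i j E \<in> kernels"
proof -
  have "exchange i j E \<subseteq> {1..n}" using kernelsD(1)[OF E] ij by (auto simp: exchange_def)
  moreover have "card (exchange i j E) = card E"
    using ij kernelsD(3)[OF E] card_gt_0_iff[of E] by (auto simp: exchange_def card_Diff_singleton)
  moreover have "A \<in> \<F>" if A: "A \<in> nsets {1..n} k" "exchange i j E \<subseteq> A" for A
  proof (cases "j \<in> A")
    case True
    then have "E \<subseteq> A" using A by (auto simp: exchange_def)
    then show ?thesis using kernelsD(4)[OF E A(1)] by simp
  next
    case False
    have iA: "i \<in> A" using A by (auto simp: exchange_def)
    have j: "j \<in> {1..n}" using ij kernelsD(1)[OF E] by auto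
    \<comment> \<open>the reverse exchange yields a set above \<open>E\<close>, from which compression leads back to \<open>A\<close>\<close>
    have "exchange j i A \<in> nsets {1..n} k" using exchange_in_nsets[OF A(1) j iA False] .
    moreover have "E \<subseteq> exchange j i A" using A ij by (auto simp: exchange_def)
    ultimately have "exchange j i A \<in> \<F>" using kernelsD(4)[OF E] by blast
    then have "exchange i j (exchange j i A) \<in> \<F>"
      by (rule compressed) (use ij iA in \<open>auto simp: exchange_def\<close>)
    moreover have "exchange i j (exchange j i A) = A" using iA False by (auto simp: exchange_def)
    ultimately show ?thesis by simp
  qed
  ultimately show ?thesis using kernelsD(2)[OF E] by (auto simp: kernels_def)
qed

lemma criticalD:
  assumes "E \<in> critical l"
  shows "E \<in> kernels" "E \<subseteq> {1..l}" "l \<in> E" "E - {l} \<notin> kernels" "finite E" "card E \<le> k"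
  using assms kernelsD by (auto simp: critical_def)

text \<open>Losing \<open>l\<close> costs at most one common element, so the two kernels have exactly \<open>t\<close> of them. If some
  \<open>i < l\<close> belonged to neither kernel, then exchanging \<open>l\<close> for \<open>i\<close> in the first would give a kernel
  with only \<open>t - 1\<close> elements in common with the second.\<close>

lemma tight_kernels_cover:
  assumes E: "E1 \<in> kernels" "E1 \<subseteq> {1..l}" "l \<in> E1" "E2 \<in> kernels" "E2 \<subseteq> {1..l}" "l \<in> E2"
    and tight: "card ((E1 - {l}) \<inter> E2) < t"
  shows "E1 \<union> E2 = {1..l}" "card E1 + card E2 = l + t"
proof -
  note fin = kernelsD(3)[OF E(1)] kernelsD(3)[OF E(4)]
  have "(E1 - {l}) \<inter> E2 = (E1 \<inter> E2) - {l}" by auto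
  then have "card (E1 \<inter> E2) - 1 < t" using tight E by (simp add: card_Diff_singleton)
  then have eq: "card (E1 \<inter> E2) = t" using card_kernels_Int[OF E(1,4)] t_pos by linarith
  show cover: "E1 \<union> E2 = {1..l}"
  proof (rule ccontr)
    assume "E1 \<union> E2 \<noteq> {1..l}"
    then obtain i where i: "i \<in> {1..l}" "i \<notin> E1" "i \<notin> E2" using E by blast
    have "exchange i l E1 \<in> kernels"
      using i E by (intro exchange_kernel) (auto simp: order_less_le)
    then have "t \<le> card (exchange i l E1 \<inter> E2)" using E(4) by (rule card_kernels_Int)
    moreover have "exchange i l E1 \<inter> E2 = (E1 - {l}) \<inter> E2" using i by (auto simp: exchange_def)
    ultimately show False using tight by simp
  qed
  show "card E1 + card E2 = l + t" using card_Un_Int[OF fin] cover eq by simp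
qed

text \<open>This describes all obstacles to deleting \<open>l\<close> from a critical kernel: they are critical kernels
  again, and of a determined size.\<close>

lemma tight_critical:
  assumes E1: "E1 \<in> critical l" and E2: "E2 \<in> kernels" "E2 \<subseteq> {1..l}"
    and tight: "card ((E1 - {l}) \<inter> E2) < t"
  shows "E2 \<in> critical l" "E1 \<union> E2 = {1..l}" "card E1 + card E2 = l + t"
proof -
  have l: "l \<in> E2"
  proof (rule ccontr)
    assume "l \<notin> E2"
    then have "(E1 - {l}) \<inter> E2 = E1 \<inter> E2" by auto
    then show False using tight card_kernels_Int[OF criticalD(1)[OF E1] E2(1)] by simp
  qed
  show "E1 \<union> E2 = {1..l}" "card E1 + card E2 = l + t"
    using tight_kernels_cover[OF criticalD(1-3)[OF E1] E2 l tight] by auto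
  have "E2 - {l} \<notin> kernels"
  proof
    assume "E2 - {l} \<in> kernels"
    then have "t \<le> card (E1 \<inter> (E2 - {l}))" by (rule card_kernels_Int[OF criticalD(1)[OF E1]])
    moreover have "E1 \<inter> (E2 - {l}) = (E1 - {l}) \<inter> E2" by auto
    ultimately show False using tight by simp
  qed
  then show "E2 \<in> critical l" using E2 l by (simp add: critical_def)
qed

text \<open>Without a partner of complementary size, \<open>E - {l}\<close> still meets every trace in \<open>t\<close> elements.
  Every \<open>k\<close>-set above \<open>E - {l}\<close> could then be added to \<open>\<F>\<close>, so by maximality it is in \<open>\<F>\<close> already,
  and \<open>E - {l}\<close> is a kernel after all.\<close>

lemma critical_partner:
  assumes E: "E \<in> critical l" and l: "l \<le> n"
    and traces: "\<And>A. A \<in> \<F> \<Longrightarrow> A \<inter> {1..l} \<in> kernels"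
  shows "\<exists>E'\<in>critical l. card E + card E' = l + t"
proof (rule ccontr)
  assume none: "\<not> ?thesis"
  note Ed = criticalD[OF E]
  have big: "t \<le> card ((E - {l}) \<inter> E')" if "E' \<in> kernels" "E' \<subseteq> {1..l}" for E'
    using tight_critical[OF E that] none by (meson not_le)
  have "E - {l} \<in> kernels"
    unfolding kernels_def
  proof (intro CollectI conjI ballI impI)
    show "E - {l} \<subseteq> {1..n}" using Ed(2) l by auto
    show "card (E - {l}) \<le> k" using Ed(6) card_Diff1_le[of E l] by linarith
    fix A assume A: "A \<in> nsets {1..n} k" "E - {l} \<subseteq> A"
    show "A \<in> \<F>"
    proof (rule ccontr)
      assume nA: "A \<notin> \<F>"
      have fA: "finite A" "card A = k" using A by (auto simp: nsets_def)
      have AB: "t \<le> card (A \<inter> B)" if "B \<in> \<F>" for B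
      proof -
        have "t \<le> card ((E - {l}) \<inter> (B \<inter> {1..l}))" using big traces[OF that] by simp
        also have "\<dots> \<le> card (A \<inter> B)" using A fA by (intro card_mono) auto
        finally show ?thesis .
      qed
      have "intersecting t (insert A \<F>)"
        using AB intersects fA t_le_k by (auto simp: intersecting_def Int_commute)
      then have "card (insert A \<F>) \<le> card \<F>" using A uniform by (intro maximum) auto
      then show False using nA finite_family by simp
    qed
  qed
  then show False using Ed(4) by simp
qed

text \<open>The members with trace in \<open>C\<close> are traded for the \<open>k\<close>-sets whose trace is \<open>E - {l}\<close> for some
  \<open>E \<in> B\<close>. If every obstacle to deleting \<open>l\<close> from a set in \<open>B\<close> lies in \<open>C\<close> and not in \<open>B\<close>, the
  result is again \<open>t\<close>-intersecting, and by maximality it is no larger than \<open>\<F>\<close>. Both sides of the claim count what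
  was gained and what was lost. None of the gained sets was in \<open>\<F>\<close>, since their traces are not kernels.\<close>

lemma replacement_bound:
  assumes l: "l \<le> n" and traces: "\<And>A. A \<in> \<F> \<Longrightarrow> A \<inter> {1..l} \<in> kernels"
    and B: "B \<subseteq> critical l" "\<And>E. E \<in> B \<Longrightarrow> card E = i" and i: "i \<le> k"
    and C: "C \<subseteq> critical l" "\<And>E. E \<in> C \<Longrightarrow> card E = j" and j: "j \<le> k"
    and loose: "\<And>E E'. E \<in> B \<Longrightarrow> E' \<in> (critical l - C) \<union> B \<Longrightarrow> E \<union> E' = {1..l} \<Longrightarrow>
      card E + card E' \<noteq> l + t"
  shows "card B * ((n - l) choose Suc (k - i)) \<le> card C * ((n - l) choose (k - j))"
proof -
  define B' where "B' = (\<lambda>E. E - {l}) ` B"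
  define K where "K = {E \<in> kernels. E \<subseteq> {1..l}} - C"
  let ?old = "{A \<in> nsets {1..n} k. A \<inter> {1..l} \<in> C}"
  let ?new = "{A \<in> nsets {1..n} k. A \<inter> {1..l} \<in> B'}"
  have BD: "finite E" "card E = i" "l \<in> E" "E \<subseteq> {1..l}" "E - {l} \<notin> kernels" if "E \<in> B" for E
  proof -
    have "E \<in> critical l" using that B(1) by blast
    then show "finite E" "card E = i" "l \<in> E" "E \<subseteq> {1..l}" "E - {l} \<notin> kernels"
      using criticalD[of E l] B(2)[OF that] by simp_all
  qed
  have BK: "t \<le> card ((E - {l}) \<inter> E')" if "E \<in> B" "E' \<in> K" for E E'
  proof (rule ccontr)
    assume "\<not> ?thesis"
    then have *: "E' \<in> critical l" "E \<union> E' = {1..l}" "card E + card E' = l + t"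
      using tight_critical[of E l E'] that B(1) by (auto simp: K_def)
    then show False using loose[OF that(1)] that(2) by (auto simp: K_def)
  qed
  have BB: "t \<le> card ((E - {l}) \<inter> (E' - {l}))" if "E \<in> B" "E' \<in> B" for E E'
  proof -
    have "E' \<in> kernels" "E' \<subseteq> {1..l}" "E \<in> critical l"
      using that B(1) criticalD[of E' l] by auto
    then have "t \<le> card ((E - {l}) \<inter> E')"
      using tight_critical[of E l E'] loose[OF that(1), of E'] that(2) by (meson UnI2 not_le)
    moreover have "(E - {l}) \<inter> E' = (E - {l}) \<inter> (E' - {l})" by auto
    ultimately show ?thesis by simp
  qed
  have KK: "t \<le> card (E \<inter> E')" if "E \<in> K" "E' \<in> K" for E E'
    using that card_kernels_Int by (auto simp: K_def)
  have tr: "t \<le> card (E \<inter> E')" if EE: "E \<in> K \<union> B'" "E' \<in> K \<union> B'" for E E'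
  proof -
    consider "E \<in> K" "E' \<in> K" | "E \<in> B'" "E' \<in> K" | "E \<in> K" "E' \<in> B'" | "E \<in> B'" "E' \<in> B'"
      using EE by blast
    then show ?thesis using KK BK BB by cases (auto simp: B'_def Int_commute)
  qed
  have trace_new: "A \<inter> {1..l} \<in> K \<union> B'" if "A \<in> (\<F> - ?old) \<union> ?new" for A
    using that traces uniform by (auto simp: K_def)
  have int: "intersecting t ((\<F> - ?old) \<union> ?new)"
    unfolding intersecting_def
  proof (intro ballI)
    fix A A' assume A: "A \<in> (\<F> - ?old) \<union> ?new" and A': "A' \<in> (\<F> - ?old) \<union> ?new"
    have "t \<le> card ((A \<inter> {1..l}) \<inter> (A' \<inter> {1..l}))" using tr trace_new[OF A] trace_new[OF A'] by blast
    also have "\<dots> \<le> card (A \<inter> A')" using A familyD by (intro card_mono) (auto simp: nsets_def)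
    finally show "t \<le> card (A \<inter> A')" .
  qed
  have fin: "finite ?old" "finite ?new" by (simp_all add: finite_imp_finite_nsets)
  have old_sub: "?old \<subseteq> \<F>"
  proof
    fix A assume A: "A \<in> ?old"
    then have "A \<inter> {1..l} \<in> kernels" using C(1) criticalD(1) by blast
    then show "A \<in> \<F>" using kernelsD(4)[of "A \<inter> {1..l}" A] A by blast
  qed
  have "B' \<inter> kernels = {}" using BD(5) by (auto simp: B'_def)
  then have new_disj: "\<F> \<inter> ?new = {}" using traces by blast
  have "card ((\<F> - ?old) \<union> ?new) = card (\<F> - ?old) + card ?new"
    using new_disj fin finite_family by (intro card_Un_disjoint) auto
  moreover have "card (\<F> - ?old) = card \<F> - card ?old" using old_sub fin by (simp add: card_Diff_subset)
  moreover have "card ?old \<le> card \<F>" using old_sub finite_family by (rule card_mono[rotated])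
  moreover have "card ((\<F> - ?old) \<union> ?new) \<le> card \<F>" using int uniform by (intro maximum) auto
  ultimately have le: "card ?new \<le> card ?old" by linarith
  show ?thesis
  proof (cases "B = {}")
    case True then show ?thesis by simp
  next
    case False
    then obtain E where "E \<in> B" by blast
    then have i1: "1 \<le> i" using BD[of E] card_gt_0_iff[of E] by auto
    have "inj_on (\<lambda>E. E - {l}) B"
      by (rule inj_onI) (metis BD(3) insert_Diff)
    then have "card B' = card B" unfolding B'_def by (rule card_image)
    moreover have "E - {l} \<in> nsets {1..l} (i - 1)" if "E \<in> B" for E
      using BD(1-4)[OF that] by (auto simp: nsets_def card_Diff_singleton)
    then have "B' \<subseteq> nsets {1..l} (i - 1)" by (auto simp: B'_def)
    then have "card ?new = card B' * ((n - l) choose (k - (i - 1)))"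
      using card_trace_in[OF l] i by simp
    moreover have "E \<in> nsets {1..l} j" if "E \<in> C" for E
      using criticalD(2,5)[of E l] C(1) C(2)[OF that] that by (auto simp: nsets_def)
    then have "C \<subseteq> nsets {1..l} j" by blast
    then have "card ?old = card C * ((n - l) choose (k - j))" using card_trace_in[OF l] j by simp
    moreover have "k - (i - 1) = Suc (k - i)" using i i1 by simp
    ultimately show ?thesis using le by (simp only:)
  qed
qed

text \<open>This is the only place that needs the full strength of the threshold on \<open>n\<close>; for \<open>s = 1\<close> and
  the least admissible \<open>n\<close> the two sides differ by one.\<close>

lemma middle_arithmetic:
  assumes "1 \<le> s" "t + s \<le> k" "t + 2 * s \<le> n"
  shows "(t + 2 * s - 1) * (k - (t + s) + 1) < s * (n - (t + 2 * s) + 1)"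
proof -
  obtain u where u: "k = t + s + u" using assms le_Suc_ex by blast
  obtain w where w: "n = t + 2 * s + w" using assms le_Suc_ex by blast
  obtain a where a: "s = a + 1" using assms(1) by (metis add.commute le_Suc_ex)
  obtain b where b: "t = b + 1" using t_pos by (metis add.commute le_Suc_ex)
  have "(b + 2) * (a + u + 2) + 1 \<le> n" using n_large u a b by simp
  then have "(a + 1) * ((b + 2) * (a + u + 2) + 2) \<le> (a + 1) * (n + 1)"
    by (intro mult_le_mono2) simp
  also have "\<dots> = (a + 1) * (w + 1) + (a + 1) * (b + 2 * a + 3)"
    using w a b by (simp add: algebra_simps)
  finally have "(b + 2 * a + 2) * (u + 1) < (a + 1) * (w + 1)"
    by (simp add: algebra_simps)
  then show ?thesis using u w a b by simp
qed

text \<open>Take two critical kernels of complementary sizes \<open>i + j = l + t\<close>.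

  If \<open>i \<noteq> j\<close>, trading all critical kernels of size \<open>j\<close> for those of size \<open>i\<close> with \<open>l\<close> deleted, and
  vice versa, gives two inequalities whose product contradicts \<open>binomial_product_less\<close>.

  If \<open>i = j\<close>, then \<open>l = t + 2 * s\<close> and \<open>i = t + s\<close>, and \<open>l\<close> is deleted
  from critical kernels of size \<open>i\<close> no two of which cover \<open>{1..l}\<close>, while the others of this size are
  given up. Those that miss one fixed element \<open>m < l\<close> have this property, and averaging over \<open>m\<close> yields an \<open>m\<close> that is missed by a fraction of at least
  \<open>s / (l - 1)\<close> of them. The inequality for this trade contradicts \<open>middle_arithmetic\<close>.\<close>

lemma no_critical_beyond_t:
  assumes l: "t < l" "l \<le> n" and traces: "\<And>A. A \<in> \<F> \<Longrightarrow> A \<inter> {1..l} \<in> kernels"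
  shows "critical l = {}"
proof (rule ccontr)
  assume "critical l \<noteq> {}"
  then obtain E1 where E1: "E1 \<in> critical l" by blast
  obtain E2 where E2: "E2 \<in> critical l" "card E1 + card E2 = l + t"
    using critical_partner[OF E1 l(2) traces] by blast
  define i j where "i = card E1" and "j = card E2"
  have ij: "i + j = l + t" "i \<le> k" "j \<le> k"
    using E1 E2 criticalD(6) by (auto simp: i_def j_def)
  define H where "H e = {E \<in> critical l. card E = e}" for e
  have finH: "finite (H e)" for e
    by (rule finite_subset[of _ "Pow {1..l}"]) (auto simp: H_def critical_def)
  have pos: "0 < card (H i)" "0 < card (H j)"
    using E1 E2 finH by (auto simp: card_gt_0_iff H_def i_def j_def)
  let ?N = "n - l" and ?p = "k - i" and ?q = "k - j"
  \<comment> \<open>here \<open>?N - ?p - ?q = n + t - 2 * k\<close>\<close>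
  have room: "?p + ?q + 2 \<le> ?N" using n_bound ij l by linarith
  show False
  proof (cases "i = j")
    case False
    have "card (H i) * (?N choose Suc ?p) \<le> card (H j) * (?N choose ?q)"
      by (rule replacement_bound[OF l(2) traces]) (use ij False in \<open>auto simp: H_def\<close>)
    moreover have "card (H j) * (?N choose Suc ?q) \<le> card (H i) * (?N choose ?p)"
      by (rule replacement_bound[OF l(2) traces]) (use ij False in \<open>auto simp: H_def\<close>)
    ultimately have "(card (H i) * (?N choose Suc ?p)) * (card (H j) * (?N choose Suc ?q))
        \<le> (card (H j) * (?N choose ?q)) * (card (H i) * (?N choose ?p))"
      by (rule mult_le_mono)
    then have "(card (H i) * card (H j)) * ((?N choose Suc ?p) * (?N choose Suc ?q))
        \<le> (card (H i) * card (H j)) * ((?N choose ?p) * (?N choose ?q))"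
      by (simp only: mult_ac)
    then have "(?N choose Suc ?p) * (?N choose Suc ?q) \<le> (?N choose ?p) * (?N choose ?q)"
      using pos by simp
    then show False using binomial_product_less[OF room] by simp
  next
    case True
    define s where "s = i - t"
    have s: "1 \<le> s" "i = t + s" "l = t + 2 * s" using ij True l by (auto simp: s_def)
    define T where "T m = {E \<in> H i. m \<notin> E}" for m
    let ?h = "card (H i)"
    \<comment> \<open>each kernel of size \<open>i\<close> contains \<open>l\<close> and misses \<open>l - i = s\<close> of the elements below \<open>l\<close>\<close>
    have "(\<Sum>m\<in>{1..<l}. card (T m)) = (\<Sum>m\<in>{1..<l}. \<Sum>E\<in>H i. if m \<notin> E then 1 else 0)"
      using finH by (simp add: T_def sum.If_cases Int_def)
    also have "\<dots> = (\<Sum>E\<in>H i. \<Sum>m\<in>{1..<l}. if m \<notin> E then 1 else 0)" by (rule sum.swap)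
    also have "\<dots> = (\<Sum>E\<in>H i. s)"
    proof (rule sum.cong[OF refl])
      fix E assume "E \<in> H i"
      then have E: "E \<subseteq> {1..l}" "l \<in> E" "finite E" "card E = i" using criticalD by (auto simp: H_def)
      have "(\<Sum>m\<in>{1..<l}. if m \<notin> E then 1 else 0) = card {m \<in> {1..<l}. m \<notin> E}"
        by (simp add: sum.If_cases Int_def)
      also have "{m \<in> {1..<l}. m \<notin> E} = {1..l} - E" using E by (auto simp: order_less_le)
      also have "card \<dots> = l - i" using E by (simp add: card_Diff_subset)
      finally show "(\<Sum>m\<in>{1..<l}. if m \<notin> E then 1 else 0) = s" using s by simp
    qed
    finally have count: "(\<Sum>m\<in>{1..<l}. card (T m)) = ?h * s" by simp
    have "\<exists>m\<in>{1..<l}. ?h * s \<le> (l - 1) * card (T m)"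
    proof (rule ccontr)
      assume "\<not> ?thesis"
      then have "(\<Sum>m\<in>{1..<l}. (l - 1) * card (T m)) < (\<Sum>m\<in>{1..<l}. ?h * s)"
        using l t_pos by (intro sum_strict_mono) (auto simp: not_le)
      then show False using count by (simp add: sum_distrib_left[symmetric])
    qed
    then obtain m where m: "m \<in> {1..<l}" "?h * s \<le> (l - 1) * card (T m)" by blast
    let ?T = "T m"
    have Tle: "card ?T \<le> ?h" "?T \<subseteq> H i" "finite ?T"
      using finH by (auto simp: T_def intro: card_mono)
    have "card ?T * (?N choose Suc ?p) \<le> card (H i - ?T) * (?N choose ?p)"
    proof (rule replacement_bound[OF l(2) traces])
      fix E E' assume E: "E \<in> ?T" and E': "E' \<in> (critical l - (H i - ?T)) \<union> ?T" and un: "E \<union> E' = {1..l}"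
      show "card E + card E' \<noteq> l + t"
      proof
        assume "card E + card E' = l + t"
        then have "E' \<in> H i" using E E' Tle ij True by (auto simp: H_def T_def)
        then have "E' \<in> ?T" using E' by auto
        then have "m \<notin> E \<union> E'" using E by (auto simp: T_def)
        then show False using un m by auto
      qed
    qed (use ij in \<open>auto simp: H_def T_def\<close>)
    moreover have "card (H i - ?T) * (?N choose ?p) + card ?T * (?N choose ?p) = ?h * (?N choose ?p)"
      using Tle by (simp add: card_Diff_subset add_mult_distrib[symmetric])
    ultimately have "card ?T * (?N choose Suc ?p) + card ?T * (?N choose ?p) \<le> ?h * (?N choose ?p)"
      by linarith
    \<comment> \<open>Pascal's rule: the gained and the kept sets together are the \<open>k\<close>-sets with trace \<open>E - {l}\<close> on \<open>{1..l - 1}\<close>\<close>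
    then have "card ?T * (Suc ?N choose Suc ?p) \<le> ?h * (?N choose ?p)"
      by (simp add: algebra_simps)
    then have "Suc ?p * (card ?T * (Suc ?N choose Suc ?p)) \<le> Suc ?p * (?h * (?N choose ?p))"
      by (rule mult_le_mono2)
    then have "card ?T * (Suc ?p * (Suc ?N choose Suc ?p)) \<le> Suc ?p * ?h * (?N choose ?p)"
      by (simp only: mult_ac)
    then have "(card ?T * Suc ?N) * (?N choose ?p) \<le> (Suc ?p * ?h) * (?N choose ?p)"
      by (simp only: Suc_times_binomial mult_ac)
    moreover have "0 < ?N choose ?p" using room by (simp add: zero_less_binomial_iff)
    ultimately have b: "card ?T * Suc ?N \<le> Suc ?p * ?h" by simp
    have "?h * s * Suc ?N \<le> (l - 1) * card ?T * Suc ?N" using m(2) by (rule mult_le_mono1)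
    also have "\<dots> = (l - 1) * (card ?T * Suc ?N)" by (simp only: mult_ac)
    also have "\<dots> \<le> (l - 1) * (Suc ?p * ?h)" using b by (rule mult_le_mono2)
    finally have "?h * (s * Suc ?N) \<le> ?h * ((l - 1) * Suc ?p)" by (simp only: mult_ac)
    then have "s * Suc ?N \<le> (l - 1) * Suc ?p" using pos by simp
    then show False using middle_arithmetic[of s] s ij(2) l(2) by simp
  qed
qed

text \<open>The least \<open>l\<close> for which all traces on \<open>{1..l}\<close> are kernels cannot exceed \<open>t\<close>, because it would
  have a critical kernel. But kernels have at least \<open>t\<close> elements, so \<open>l = t\<close> and all traces are
  equal to \<open>{1..t}\<close>.\<close>

theorem family_eq_star: "\<F> = star {1..n} k {1..t}"
proof -
  define traced where "traced l \<longleftrightarrow> (\<forall>A\<in>\<F>. A \<inter> {1..l} \<in> kernels)" for l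
  have "A \<inter> {1..n} \<in> kernels" if "A \<in> \<F>" for A
    using family_subset_kernels[OF that] familyD(1)[OF that] by (simp add: Int_absorb2)
  then have tn: "traced n" by (simp add: traced_def)
  define l where "l = (LEAST l. traced l)"
  have tl: "traced l" unfolding l_def using tn by (rule LeastI)
  have ln: "l \<le> n" unfolding l_def using tn by (rule Least_le)
  have "l \<le> t"
  proof (rule ccontr)
    assume "\<not> l \<le> t"
    then have lt: "t < l" "0 < l" by auto
    have "\<not> traced (l - 1)"
      using not_less_Least[of "l - 1" traced] lt unfolding l_def[symmetric] by simp
    then obtain A where A: "A \<in> \<F>" "A \<inter> {1..l - 1} \<notin> kernels" by (auto simp: traced_def)
    have Al: "A \<inter> {1..l} \<in> kernels" using tl A by (auto simp: traced_def)
    have eq: "A \<inter> {1..l} - {l} = A \<inter> {1..l - 1}" using lt by auto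
    have "l \<in> A \<inter> {1..l}" using Al A(2) eq by (metis Diff_empty Diff_insert0)
    then have "A \<inter> {1..l} \<in> critical l" using Al A(2) eq by (simp add: critical_def)
    then show False using no_critical_beyond_t[OF lt(1) ln] tl by (auto simp: traced_def)
  qed
  have "{1..t} \<subseteq> A" if "A \<in> \<F>" for A
  proof -
    have K: "A \<inter> {1..l} \<in> kernels" using tl that by (simp add: traced_def)
    then have "t \<le> card (A \<inter> {1..l})" using card_kernels_Int[OF K K] by simp
    moreover have "card (A \<inter> {1..l}) \<le> card {1..l}" by (rule card_mono) auto
    ultimately have "l = t" "card (A \<inter> {1..l}) = card {1..l}" using \<open>l \<le> t\<close> by simp_all
    then show ?thesis using card_subset_eq[of "{1..l}" "A \<inter> {1..l}"] by auto
  qed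
  then have sub: "\<F> \<subseteq> star {1..n} k {1..t}" using uniform by (auto simp: star_def)
  have "card (star {1..n} k {1..t}) \<le> card \<F>"
    using star_intersecting[of "{1..t}" "{1..n}" k] by (intro maximum star_subset_nsets) simp
  then show ?thesis using sub by (intro card_seteq) auto
qed

end

section \<open>Pairwise intersecting families\<close>

text \<open>Compression leads from the given family to a compressed one, and \<open>star_if_compress_star\<close> leads
  back.\<close>

lemma maximum_intersecting_family_is_star:
  fixes n k t :: nat and \<F> :: "nat set set"
  assumes t: "1 \<le> t" "t \<le> k" and n: "(t + 1) * (k - t + 1) < n"
    and "\<F> \<subseteq> nsets {1..n} k" and "intersecting t \<F>"
    and "\<And>\<G>. \<G> \<subseteq> nsets {1..n} k \<Longrightarrow> intersecting t \<G> \<Longrightarrow> card \<G> \<le> card \<F>"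
  shows "\<exists>T\<subseteq>{1..n}. card T = t \<and> \<F> = star {1..n} k T"
  using assms(4-6)
proof (induction "weight \<F>" arbitrary: \<F> rule: less_induct)
  case less
  note F = less.prems
  have fin: "finite \<F>" using F(1) by (rule finite_subset) (simp add: finite_imp_finite_nsets)
  have finA: "finite A" "A \<subseteq> {1..n}" if "A \<in> \<F>" for A using F(1) that by (auto simp: nsets_def)
  show ?case
  proof (cases "\<exists>A\<in>\<F>. \<exists>i j. 1 \<le> i \<and> i < j \<and> movable i j \<F> A")
    case True
    then obtain A i j where A: "A \<in> \<F>" and ij: "1 \<le> i" "i < j" and mov: "movable i j \<F> A" by blast
    have V: "i \<in> {1..n}" "j \<in> {1..n}" using finA(2)[OF A] mov ij by (auto simp: movable_def)
    have "weight (compress i j \<F>) < weight \<F>"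
      using ij(2) fin finA(1) A mov by (rule weight_compress)
    moreover have "compress i j \<F> \<subseteq> nsets {1..n} k" using F(1) V(1) by (rule compress_subset_nsets)
    moreover have "intersecting t (compress i j \<F>)" using F(2) finA(1) by (rule intersecting_compress)
    moreover have "card \<G> \<le> card (compress i j \<F>)"
      if "\<G> \<subseteq> nsets {1..n} k" "intersecting t \<G>" for \<G>
      using F(3)[OF that] by (simp add: card_compress)
    ultimately obtain T where T: "T \<subseteq> {1..n}" "card T = t" "compress i j \<F> = star {1..n} k T"
      using less.hyps[of "compress i j \<F>"] by blast
    have "2 * (k - t) + t + 2 \<le> n" using threshold_imp_linear_bound[OF t n] t(2) by linarith
    then have "2 * (k - t) + t + 2 \<le> card {1..n}" by simp
    then show ?thesis
      using star_if_compress_star[of "{1..n}" \<F> k i j T t] F V T t ij(2) by auto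
  next
    case False
    interpret maximum_compressed_family n k t \<F>
    proof unfold_locales
      fix A i j assume "A \<in> \<F>" "1 \<le> i" "i < j" "j \<in> A" "i \<notin> A"
      then show "exchange i j A \<in> \<F>" using False unfolding movable_def by blast
    qed (fact t n F)+
    have "t \<le> n" using n_bound t_le_k by linarith
    then show ?thesis using family_eq_star by (intro exI[of _ "{1..t}"]) auto
  qed
qed

text \<open>The sharp form of the theorem of Erdos, Ko and Rado due to Frankl and Wilson, with uniqueness.
  It follows by comparison with a family of maximum size, which is a star.\<close>

theorem intersecting_family_bound:
  fixes n k t :: nat and \<F> :: "nat set set"
  assumes t: "1 \<le> t" "t \<le> k" and n: "(t + 1) * (k - t + 1) < n"
    and F: "\<F> \<subseteq> nsets {1..n} k" "intersecting t \<F>"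
  shows "card \<F> \<le> (n - t) choose (k - t)"
    and "card \<F> = (n - t) choose (k - t) \<Longrightarrow> \<exists>T\<subseteq>{1..n}. card T = t \<and> \<F> = star {1..n} k T"
proof -
  let ?S = "{\<G>. \<G> \<subseteq> nsets {1..n} k \<and> intersecting t \<G>}"
  have finS: "finite ?S"
    by (rule finite_subset[of _ "Pow (nsets {1..n} k)"]) (auto simp: finite_imp_finite_nsets)
  have "Max (card ` ?S) \<in> card ` ?S" using finS F by (intro Max_in) auto
  then obtain \<M> where M: "\<M> \<in> ?S" "card \<M> = Max (card ` ?S)" by force
  have max: "card \<G> \<le> card \<M>" if "\<G> \<subseteq> nsets {1..n} k" "intersecting t \<G>" for \<G>
    using finS that by (simp add: M(2))
  obtain T where T: "T \<subseteq> {1..n}" "card T = t" "\<M> = star {1..n} k T"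
    using maximum_intersecting_family_is_star[OF t n, of \<M>] M(1) max by auto
  have cM: "card \<M> = (n - t) choose (k - t)" using card_star[of "{1..n}" T k] T t by simp
  show "card \<F> \<le> (n - t) choose (k - t)" using max[OF F] cM by simp
  show "\<exists>T\<subseteq>{1..n}. card T = t \<and> \<F> = star {1..n} k T" if "card \<F> = (n - t) choose (k - t)"
    using maximum_intersecting_family_is_star[OF t n F] max that cM by simp
qed

section \<open>From many sets to two\<close>

definition has_core :: "nat \<Rightarrow> 'a set set \<Rightarrow> bool" where
  "has_core t \<F> \<longleftrightarrow> (\<exists>T. finite T \<and> card T = t \<and> (\<forall>A\<in>\<F>. T \<subseteq> A))"

lemma has_core_SucD: 
  assumes "has_core (Suc t) \<F>"
  shows "has_core t \<F>"
proof -
  obtain T where T: "finite T" "card T = Suc t" "\<forall>A\<in>\<F>. T \<subseteq> A"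
    using assms by (auto simp: has_core_def)
  then have "t \<le> card T" by simp
  then obtain S where "S \<subseteq> T" "card S = t" "finite S" by (rule obtain_subset_with_card_n)
  then show ?thesis using T unfolding has_core_def by blast
qed

text \<open>If some \<open>d\<close> members met in only \<open>t\<close> elements, every further member would have to contain
  all of them, and they would form a core.\<close>

lemma wise_intersecting_Suc_if_no_core:
  assumes d: "1 \<le> d" and wise: "wise_intersecting (Suc d) t \<F>"
    and fin: "\<And>A. A \<in> \<F> \<Longrightarrow> finite A" and no_core: "\<not> has_core t \<F>"
  shows "wise_intersecting d (Suc t) \<F>"
  unfolding wise_intersecting_def
proof (intro allI impI)
  fix F :: "nat \<Rightarrow> 'a set" assume F: "\<forall>i\<in>{1..d}. F i \<in> \<F>"
  let ?I = "\<Inter>i\<in>{1..d}. F i"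
  have F1: "F 1 \<in> \<F>" "?I \<subseteq> F 1" using F d by auto
  have fI: "finite ?I" using F1 fin finite_subset by blast
  have Int: "t \<le> card (?I \<inter> A)" if "A \<in> \<F>" for A
  proof -
    let ?G = "F(Suc d := A)"
    have "\<forall>i\<in>{1..Suc d}. ?G i \<in> \<F>" using F that by (auto simp: le_Suc_eq)
    then have "t \<le> card (\<Inter>i\<in>{1..Suc d}. ?G i)"
      using wise unfolding wise_intersecting_def by blast
    also have "{1..Suc d} = insert (Suc d) {1..d}" by auto
    also have "(\<Inter>i\<in>insert (Suc d) {1..d}. ?G i) = A \<inter> (\<Inter>i\<in>{1..d}. ?G i)"
      unfolding INF_insert by (simp only: fun_upd_same)
    also have "(\<Inter>i\<in>{1..d}. ?G i) = ?I" by (rule INF_cong) auto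
    finally show ?thesis by (simp only: Int_commute)
  qed
  show "Suc t \<le> card ?I"
  proof (rule ccontr)
    assume "\<not> Suc t \<le> card ?I"
    then have le: "card ?I \<le> t" by simp
    have eq: "?I \<inter> A = ?I" if "A \<in> \<F>" for A
      using Int[OF that] le fI by (intro card_seteq) auto
    then have "t \<le> card ?I" using Int[OF F1(1)] eq[OF F1(1)] by simp
    then have "has_core t \<F>"
      unfolding has_core_def using le fI eq by (intro exI[of _ ?I]) auto
    with no_core show False by simp
  qed
qed

lemma intersecting_if_wise_intersecting:
  assumes "2 \<le> d" "wise_intersecting d t \<F>" 
    and fin: "\<And>A. A \<in> \<F> \<Longrightarrow> finite A" and "\<not> has_core t \<F>"
  shows "intersecting (t + d - 2) \<F>"
  using assms(1,2,4)
proof (induction d arbitrary: t rule: nat_induct_at_least)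
  case base
  show ?case
    unfolding intersecting_def
  proof (intro ballI)
    fix A B assume "A \<in> \<F>" "B \<in> \<F>"
    then have "\<forall>i\<in>{1..2::nat}. (if i = 1 then A else B) \<in> \<F>" by simp
    then have "t \<le> card (\<Inter>i\<in>{1..2::nat}. if i = 1 then A else B)"
      using base(1) unfolding wise_intersecting_def
      by (elim allE[where x = "\<lambda>i. if i = 1 then A else B"] impE)
    also have "{1..2::nat} = {1, 2}" by auto
    finally show "t + 2 - 2 \<le> card (A \<inter> B)" by (simp add: Int_commute)
  qed
next
  case (Suc d)
  have "wise_intersecting d (Suc t) \<F>"
    using Suc.hyps Suc.prems fin by (intro wise_intersecting_Suc_if_no_core) auto
  then show ?case using Suc.IH[of "Suc t"] Suc.prems(2) has_core_SucD by auto
qed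

lemma binomial_diagonal_mono: "(N choose K) \<le> ((N + e) choose (K + e))"
  by (induction e) auto

lemma binomial_diagonal_strict_mono:
  assumes "K < N" "0 < e"
  shows "(N choose K) < ((N + e) choose (K + e))"
proof -
  have "0 < N choose Suc K" using assms(1) by (simp add: zero_less_binomial_iff)
  then have "(N choose K) < (Suc N choose Suc K)" by simp
  also have "\<dots> \<le> ((Suc N + (e - 1)) choose (Suc K + (e - 1)))" by (rule binomial_diagonal_mono)
  finally show ?thesis using assms(2) by simp
qed

text \<open>The pairwise intersections have at least \<open>s = t + d - 2\<close> elements, and for this \<open>s\<close> the hypothesis
  on \<open>n\<close> is the threshold of \<open>intersecting_family_bound\<close>. The resulting bound
  \<open>(n - s) choose (k - s)\<close> is strictly smaller than required if \<open>d > 2\<close>; if \<open>d = 2\<close>, equality would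
  make the family a star, which has a core.\<close>

lemma card_less_if_no_core:
  fixes n k d t :: nat and \<F> :: "nat set set"
  assumes d: "2 \<le> d" and t: "1 \<le> t"
    and n: "int n > (int t + int d - 1) * (int k - int t - int d + 3)"
    and F: "\<F> \<subseteq> nsets {1..n} k" "wise_intersecting d t \<F>" and no_core: "\<not> has_core t \<F>"
  shows "card \<F> < (n - t) choose (k - t)"
proof -
  define e where "e = d - 2"
  define s where "s = t + e"
  have s: "int s = int t + int d - 2" "1 \<le> s" using d t by (auto simp: s_def e_def)
  have fin: "finite A" if "A \<in> \<F>" for A using F(1) that by (auto simp: nsets_def)
  have int: "intersecting s \<F>"
    using intersecting_if_wise_intersecting[OF d F(2) fin no_core] d by (simp add: s_def e_def)
  have "\<F> \<noteq> {}"
  proof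
    assume "\<F> = {}"
    then have "has_core t \<F>" unfolding has_core_def by (intro exI[of _ "{1..t}"]) auto
    with no_core show False by simp
  qed
  then obtain A where A: "A \<in> \<F>" by blast
  then have sk: "s \<le> k" using intersectingD[OF int A A] F(1) by (auto simp: nsets_def)
  have "int (s + 1) = int t + int d - 1" "int (k - s + 1) = int k - int t - int d + 3"
    using s(1) sk by (simp_all add: of_nat_diff)
  then have "int ((s + 1) * (k - s + 1)) = (int t + int d - 1) * (int k - int t - int d + 3)"
    by (simp only: of_nat_mult)
  then have ns: "(s + 1) * (k - s + 1) < n" using n by linarith
  note bound = intersecting_family_bound[OF s(2) sk ns F(1) int]
  have kn: "k < n" using threshold_imp_linear_bound[OF s(2) sk ns] sk by linarith
  have ne: "n - t = (n - s) + e" "k - t = (k - s) + e" using kn sk by (auto simp: s_def)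
  show ?thesis
  proof (cases "e = 0")
    case True
    then have "s = t" by (simp add: s_def)
    moreover have "card \<F> \<noteq> (n - s) choose (k - s)"
    proof
      assume "card \<F> = (n - s) choose (k - s)"
      then obtain T where "T \<subseteq> {1..n}" "card T = s" "\<F> = star {1..n} k T" using bound(2) by blast
      then have "has_core t \<F>"
        unfolding has_core_def star_def using \<open>s = t\<close> finite_subset[of T "{1..n}"]
        by (intro exI[of _ T]) auto
      with no_core show False by simp
    qed
    ultimately show ?thesis using bound(1) by simp
  next
    case False
    have "(n - s) choose (k - s) < (n - t) choose (k - t)"
      unfolding ne using False kn sk by (intro binomial_diagonal_strict_mono) auto
    then show ?thesis using bound(1) by simp
  qed
qed

text \<open>A family with a core lies in a star, and equality makes it the whole star. The empty family attains the bound
  only if \<open>n < k\<close>, when the standard star is empty as well.\<close>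

theorem theorem7:
  fixes n k d t :: nat and \<F> :: "nat set set"
  assumes "k \<ge> t" and "d \<ge> 2" and "t \<ge> 1"
    and "int n > (int t + int d - 1) * (int k - int t - int d + 3)"
    and "\<F> \<subseteq> nsets {1..n} k"
    and "wise_intersecting d t \<F>"
  shows "card \<F> \<le> (n - t) choose (k - t) \<and>
    (card \<F> = (n - t) choose (k - t) \<longrightarrow>
      isomorphic_families n \<F> {F \<in> nsets {1..n} k. {1..t} \<subseteq> F})"
proof (cases "has_core t \<F>")
  case False
  then show ?thesis using card_less_if_no_core[OF assms(2-6)] by simp
next
  case True
  show ?thesis
  proof (cases "\<F> = {}")
    case True
    have "isomorphic_families n \<F> {F \<in> nsets {1..n} k. {1..t} \<subseteq> F}"
      if "(n - t) choose (k - t) = 0"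
    proof -
      have "n < k" using that assms(1) by (auto simp: binomial_eq_0_iff)
      then have "nsets {1..n} k = {}" by (simp add: nsets_eq_empty)
      then show ?thesis
        using True permutes_id[of "{1..n}"] unfolding isomorphic_families_def by (intro exI[of _ id]) auto
    qed
    then show ?thesis using True by simp
  next
    case False
    obtain T where T: "card T = t" "\<And>A. A \<in> \<F> \<Longrightarrow> T \<subseteq> A" using True by (auto simp: has_core_def)
    then have Tn: "T \<subseteq> {1..n}" using False assms(5) by (fastforce simp: nsets_def)
    have sub: "\<F> \<subseteq> star {1..n} k T" using assms(5) T(2) by (auto simp: star_def)
    have card: "card (star {1..n} k T) = (n - t) choose (k - t)"
      using card_star[of "{1..n}" T k] Tn T(1) assms(1) by simp
    have "card \<F> \<le> (n - t) choose (k - t)"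
      unfolding card[symmetric] using sub by (intro card_mono) auto
    moreover have "isomorphic_families n \<F> {F \<in> nsets {1..n} k. {1..t} \<subseteq> F}"
      if "card \<F> = (n - t) choose (k - t)"
    proof -
      have "\<F> = star {1..n} k T" using sub that card by (intro card_subset_eq) auto
      then show ?thesis using star_isomorphic_initial[OF Tn T(1)] by (simp add: star_def)
    qed
    ultimately show ?thesis by blast
  qed
qed

end
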